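(* Let $N\ge 1$ be an integer, let $\mu$ be a probability measure on the totally ordered set $\{1<2<\cdots<N\}$, and for every integer $i\ge 1$ let $p_i:\{1,\ldots,N\}\to\mathbb{R}$ be a nonnegative monotone nondecreasing function. For $j\in\{1,\ldots,N\}$ let $p(j)=p_1(j)t+p_2(j)t^2+\cdots\in\mathbb{R}[[t]]$. Then all coefficients of the formal power series $$1-\prod_{j=1}^{N}(1-p(j))^{\mu(j)}\in\mathbb{R}[[t]]$$ are nonnegative.
   Context: For a formal power series $q\in\mathbb{R}[[t]]$ with zero constant term and a real number $a$, the power $(1-q)^a$ is the formal power series $\exp(a\ln(1-q))$, where $\ln(1-q)=-\sum_{i\ge1}q^i/i$. *)

theory Defs
  imports "HOL-Probability.Probability" "HOL-Computational_Algebra.Formal_Power_Series"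
begin

text \<open>
  Both definitions are meant for \<open>q\<close> with zero constant term; this is what makes
  the composition \<open>f oo q\<close> the substitution of \<open>q\<close> into \<open>f\<close>.
\<close>

definition fps_ln_one_minus :: "real fps \<Rightarrow> real fps" where
  "fps_ln_one_minus q = - (Abs_fps (\<lambda>i. if i = 0 then 0 else 1 / real i) oo q)"

definition fps_one_minus_powr :: "real fps \<Rightarrow> real \<Rightarrow> real fps" where
  "fps_one_minus_powr q a = fps_exp 1 oo (fps_const a * fps_ln_one_minus q)"

text \<open>The series $p_1(j) t + p_2(j) t^2 + \cdots$; the value \<open>p 0\<close> is ignored.\<close>

definition fps_at :: "(nat \<Rightarrow> nat \<Rightarrow> real) \<Rightarrow> nat \<Rightarrow> real fps" where
  "fps_at p j = Abs_fps (\<lambda>i. if i = 0 then 0 else p i j)"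

end

theory Submission imports Defs begin

text \<open>
  The product is a weighted geometric mean of the series \<open>1 - p(j)\<close>, so it has the form
  \<open>1 - r\<close> with \<open>ln (1 - r) = (\<Sum>j. \<mu>(j) ln (1 - p(j)))\<close>. The assertion that \<open>r\<close> has nonnegative
  coefficients is too weak for an induction on the number of points. The stronger assertion that
  \<open>r\<close> dominates the smallest series \<open>p(1)\<close> coefficientwise is inductive: by associativity of means
  it reduces to the mean of two series.

  For two series \<open>p \<le> q\<close> with nonnegative coefficients and a weight \<open>0 \<le> b \<le> 1\<close>, write
  \<open>1 - q = (1 - p)(1 - x)\<close> with \<open>x = (q - p)/(1 - p)\<close>, which is again nonnegative. The mean is
  \<open>1 - r = (1 - p)(1 - x)\<^sup>b\<close>, hence \<open>r - p = (1 - p)(1 - (1 - x)\<^sup>b)\<close>. The binomial series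
  \<open>1 - (1 - X)\<^sup>b\<close> has the form \<open>X T\<close> with nonnegative coefficients in \<open>T\<close>, because \<open>0 \<le> b \<le> 1\<close>.
  The factor \<open>1 - p\<close>, which has negative coefficients, is absorbed by the denominator of
  \<open>x\<close>: the difference is \<open>r - p = (q - p) T(x) \<ge> 0\<close>. This is lemma \<open>two_point_mean\<close>;
  the induction, which starts at the largest point and adds smaller ones, is lemma \<open>chain_mean\<close>.
\<close>

unbundle no vec_syntax
unbundle fps_syntax

section \<open>Coefficientwise nonnegative power series\<close>

definition fps_nonneg :: "real fps \<Rightarrow> bool" where
  "fps_nonneg f \<longleftrightarrow> (\<forall>n. f $ n \<ge> 0)"

lemma fps_nonneg_1: "fps_nonneg 1"
  by (simp add: fps_nonneg_def)

lemma fps_nonneg_mult: "fps_nonneg f \<Longrightarrow> fps_nonneg g \<Longrightarrow> fps_nonneg (f * g)"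
  by (auto simp: fps_nonneg_def fps_mult_nth intro!: sum_nonneg)

lemma fps_nonneg_add: "fps_nonneg f \<Longrightarrow> fps_nonneg g \<Longrightarrow> fps_nonneg (f + g)"
  by (auto simp: fps_nonneg_def)

lemma fps_nonneg_power: "fps_nonneg f \<Longrightarrow> fps_nonneg (f ^ n)"
  by (induction n) (auto simp: fps_nonneg_1 fps_nonneg_mult)

lemma fps_nonneg_compose:
  assumes "fps_nonneg f" "fps_nonneg g"
  shows "fps_nonneg (f oo g)"
  using assms fps_nonneg_power[OF assms(2)]
  by (auto simp: fps_nonneg_def fps_compose_nth intro!: sum_nonneg)

lemma inverse_one_minus_fps:
  fixes q :: "real fps"
  assumes "q $ 0 = 0"
  shows "inverse (1 - q) = Abs_fps (\<lambda>_. 1) oo q"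
proof -
  have "Abs_fps (\<lambda>_. 1 :: real) * (1 - fps_X) = 1"
    by (rule fps_ext) (simp add: algebra_simps)
  hence "(Abs_fps (\<lambda>_. 1 :: real) oo q) * ((1 - fps_X) oo q) = 1"
    using fps_compose_mult_distrib[OF assms, of "Abs_fps (\<lambda>_. 1)" "1 - fps_X"] by simp
  hence "(1 - q) * (Abs_fps (\<lambda>_. 1 :: real) oo q) = 1"
    using assms by (simp add: fps_compose_sub_distrib mult.commute)
  thus ?thesis by (rule fps_inverse_unique)
qed

lemma fps_nonneg_inverse_one_minus:
  assumes "fps_nonneg q" "q $ 0 = 0"
  shows "fps_nonneg (inverse (1 - q))"
  unfolding inverse_one_minus_fps[OF assms(2)]
  by (rule fps_nonneg_compose[OF _ assms(1)]) (simp add: fps_nonneg_def)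

section \<open>Exponential and logarithm of power series\<close>

abbreviation fps_Exp :: "real fps \<Rightarrow> real fps" where
  "fps_Exp f \<equiv> fps_exp 1 oo f"

lemma fps_linear_ODE_unique:
  fixes F G h :: "real fps"
  assumes "fps_deriv F = h * F" "fps_deriv G = h * G" "F $ 0 = G $ 0"
  shows "F = G"
proof (rule fps_ext)
  fix n
  show "F $ n = G $ n"
  proof (induction n rule: less_induct)
    case (less n)
    show ?case
    proof (cases n)
      case 0
      thus ?thesis using assms(3) by simp
    next
      case (Suc m)
      have "(h * F) $ m = (h * G) $ m"
        unfolding fps_mult_nth using less Suc by (intro sum.cong) auto
      hence "fps_deriv F $ m = fps_deriv G $ m" by (simp add: assms)
      thus ?thesis using Suc by (simp del: of_nat_Suc)
    qed
  qed
qed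

lemma fps_deriv_Exp:
  assumes "f $ 0 = 0"
  shows "fps_deriv (fps_Exp f) = fps_deriv f * fps_Exp f"
  using fps_compose_deriv[OF assms, of "fps_exp 1"] by (simp add: mult.commute)

lemma fps_Exp_add:
  assumes "f $ 0 = 0" "g $ 0 = 0"
  shows "fps_Exp (f + g) = fps_Exp f * fps_Exp g"
  by (rule fps_linear_ODE_unique[where h = "fps_deriv f + fps_deriv g"])
     (simp_all add: assms fps_deriv_Exp algebra_simps)

lemma fps_Exp_sum:
  assumes "finite A" "\<And>j. j \<in> A \<Longrightarrow> f j $ 0 = 0"
  shows "fps_Exp (\<Sum>j\<in>A. f j) = (\<Prod>j\<in>A. fps_Exp (f j))"
  using assms by (induction A) (simp_all add: fps_Exp_add fps_sum_nth)

lemma fps_ln_one_minus_nth_0 [simp]: "fps_ln_one_minus q $ 0 = 0"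
  by (simp add: fps_ln_one_minus_def)

lemma fps_deriv_ln_one_minus:
  assumes "q $ 0 = 0"
  shows "fps_deriv (fps_ln_one_minus q) = - (fps_deriv q * inverse (1 - q))"
proof -
  have "fps_deriv (Abs_fps (\<lambda>i. if i = 0 then 0 else 1 / real i)) = Abs_fps (\<lambda>_. 1)"
    by (rule fps_ext) simp
  thus ?thesis
    using assms
    by (simp add: fps_ln_one_minus_def fps_compose_deriv inverse_one_minus_fps mult.commute)
qed

lemma fps_Exp_ln_one_minus:
  assumes "q $ 0 = 0"
  shows "fps_Exp (fps_ln_one_minus q) = 1 - q"
proof (rule fps_linear_ODE_unique)
  show "fps_deriv (fps_Exp (fps_ln_one_minus q))
      = fps_deriv (fps_ln_one_minus q) * fps_Exp (fps_ln_one_minus q)"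
    by (simp add: fps_deriv_Exp)
  have "inverse (1 - q) * (1 - q) = 1"
    by (rule inverse_mult_eq_1) (simp add: assms)
  thus "fps_deriv (1 - q) = fps_deriv (fps_ln_one_minus q) * (1 - q)"
    by (simp add: fps_deriv_ln_one_minus assms mult.assoc)
qed (simp add: assms)

lemma fps_ln_one_minus_Exp:
  assumes "f $ 0 = 0"
  shows "fps_ln_one_minus (1 - fps_Exp f) = f"
proof -
  have "fps_Exp f * inverse (fps_Exp f) = 1"
    by (rule inverse_mult_eq_1') simp
  hence "fps_deriv (fps_ln_one_minus (1 - fps_Exp f)) = fps_deriv f"
    by (simp add: fps_deriv_ln_one_minus fps_deriv_Exp assms mult.assoc)
  thus ?thesis by (simp add: fps_deriv_eq_iff assms)
qed

lemma fps_ln_one_minus_mult: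
  assumes "p $ 0 = 0" "x $ 0 = 0" "1 - q = (1 - p) * (1 - x)"
  shows "fps_ln_one_minus q = fps_ln_one_minus p + fps_ln_one_minus x"
proof -
  have "fps_Exp (fps_ln_one_minus p + fps_ln_one_minus x) = 1 - q"
    by (simp add: fps_Exp_add fps_Exp_ln_one_minus assms)
  thus ?thesis
    using fps_ln_one_minus_Exp[of "fps_ln_one_minus p + fps_ln_one_minus x"] by simp
qed

section \<open>The binomial series\<close>

lemma fps_one_minus_powr_eq_compose:
  assumes "x $ 0 = 0"
  shows "fps_one_minus_powr x b = fps_one_minus_powr fps_X b oo x"
  using assms
  by (simp add: fps_one_minus_powr_def fps_ln_one_minus_def fps_compose_assoc[symmetric]
      fps_compose_mult_distrib fps_compose_uminus)

text \<open>
  The differential equation \<open>(1 - X) W' = - b W\<close> of \<open>W = (1 - X)\<^sup>b\<close>, read off at \<open>X\<^sup>n\<close>. From degree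
  \<open>1\<close> on the factor \<open>n - b\<close> is nonnegative if \<open>b \<le> 1\<close>, so all coefficients beyond the constant
  one share the sign of the linear coefficient \<open>- b\<close>.
\<close>

lemma fps_one_minus_powr_X_Suc:
  "real (Suc n) * fps_one_minus_powr fps_X b $ Suc n = (real n - b) * fps_one_minus_powr fps_X b $ n"
proof -
  define W where "W = fps_one_minus_powr fps_X b"
  have "inverse (1 - fps_X) * (1 - fps_X :: real fps) = 1"
    by (rule inverse_mult_eq_1) simp
  hence 1: "(1 - fps_X) * (W * inverse (1 - fps_X)) = W"
    by (simp add: ac_simps)
  have "fps_deriv W = - (fps_const b * (W * inverse (1 - fps_X)))"
    by (simp add: W_def fps_one_minus_powr_def fps_deriv_Exp fps_deriv_ln_one_minus ac_simps)
  hence "(1 - fps_X) * fps_deriv W = - (fps_const b * ((1 - fps_X) * (W * inverse (1 - fps_X))))"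
    by (simp add: ac_simps)
  hence "(1 - fps_X) * fps_deriv W = - (fps_const b * W)" by (simp only: 1)
  hence "((1 - fps_X) * fps_deriv W) $ n = - b * W $ n" by simp
  thus ?thesis unfolding W_def[symmetric]
    by (cases n) (simp_all add: algebra_simps)
qed

lemma fps_one_minus_powr_X_nonpos:
  assumes "0 \<le> b" "b \<le> 1"
  shows "fps_one_minus_powr fps_X b $ Suc n \<le> 0"
proof (induction n)
  case 0
  show ?case using fps_one_minus_powr_X_Suc[of 0 b] assms
    by (simp add: fps_one_minus_powr_def)
next
  case (Suc n)
  have "real (Suc (Suc n)) * fps_one_minus_powr fps_X b $ Suc (Suc n) \<le> 0"
    unfolding fps_one_minus_powr_X_Suc using Suc assms by (intro mult_nonneg_nonpos) auto
  thus ?case by (simp add: mult_le_0_iff del: of_nat_Suc)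
qed

text \<open>
  Splitting off the factor \<open>x\<close> leaves a cofactor that is nonnegative by itself; a bare
  nonnegativity statement for \<open>1 - (1 - x)\<^sup>b\<close> would not survive the multiplication by \<open>1 - p\<close>
  in the two-point mean.
\<close>

lemma one_minus_powr_factor:
  assumes "0 \<le> b" "b \<le> 1" "fps_nonneg x" "x $ 0 = 0"
  obtains T where "fps_nonneg T" "1 - fps_one_minus_powr x b = x * T"
proof -
  define T where "T = Abs_fps (\<lambda>n. - fps_one_minus_powr fps_X b $ Suc n)"
  have "1 - fps_one_minus_powr fps_X b = fps_X * T"
    by (rule fps_ext) (auto simp: T_def fps_one_minus_powr_def gr0_conv_Suc)
  hence "(1 - fps_one_minus_powr fps_X b) oo x = x * (T oo x)"
    using assms by (simp add: fps_compose_mult_distrib)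
  hence "1 - fps_one_minus_powr x b = x * (T oo x)"
    using assms by (simp add: fps_compose_sub_distrib fps_one_minus_powr_eq_compose[of x])
  moreover have "fps_nonneg (T oo x)"
    using assms fps_one_minus_powr_X_nonpos[OF assms(1,2)]
    by (intro fps_nonneg_compose) (auto simp: fps_nonneg_def T_def)
  ultimately show ?thesis using that by blast
qed

section \<open>Geometric means of chains\<close>

text \<open>
  Coefficientwise domination \<open>p \<le> q\<close> is expressed as \<^prop>\<open>fps_nonneg (q - p)\<close>, and means are taken
  on the logarithmic side, where they are linear.
\<close>

lemma two_point_mean:
  assumes p: "fps_nonneg p" "p $ 0 = 0" and q: "fps_nonneg (q - p)" "q $ 0 = 0"
    and b: "0 \<le> b" "b \<le> 1"
  obtains r where "r $ 0 = 0" "fps_nonneg (r - p)"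
    "fps_ln_one_minus r = fps_const (1 - b) * fps_ln_one_minus p + fps_const b * fps_ln_one_minus q"
proof -
  define x where "x = (q - p) * inverse (1 - p)"
  have x: "fps_nonneg x" "x $ 0 = 0"
    unfolding x_def using p q
    by (auto intro: fps_nonneg_mult fps_nonneg_inverse_one_minus)
  have "inverse (1 - p) * (1 - p) = 1"
    by (rule inverse_mult_eq_1) (simp add: p)
  hence px: "(1 - p) * x = q - p"
    by (simp add: x_def mult.assoc mult.commute[of "1 - p"])
  hence "1 - q = (1 - p) * (1 - x)" by (simp add: algebra_simps)
  hence Lq: "fps_ln_one_minus q = fps_ln_one_minus p + fps_ln_one_minus x"
    by (rule fps_ln_one_minus_mult[OF p(2) x(2)])
  define f where
    "f = fps_const (1 - b) * fps_ln_one_minus p + fps_const b * fps_ln_one_minus q"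
  have "f = (fps_const (1 - b) + fps_const b) * fps_ln_one_minus p + fps_const b * fps_ln_one_minus x"
    unfolding f_def Lq by (simp only: distrib_left distrib_right add_ac)
  hence f: "f = fps_ln_one_minus p + fps_const b * fps_ln_one_minus x"
    by simp
  have Ef: "fps_Exp f = (1 - p) * fps_one_minus_powr x b"
    by (simp add: f fps_Exp_add fps_Exp_ln_one_minus p fps_one_minus_powr_def)
  obtain T where T: "fps_nonneg T" "1 - fps_one_minus_powr x b = x * T"
    using one_minus_powr_factor[OF b x] by blast
  have "1 - fps_Exp f - p = (1 - p) * (1 - fps_one_minus_powr x b)"
    by (simp add: Ef algebra_simps)
  \<comment> \<open>The denominator of \<open>x\<close> cancels the factor \<open>1 - p\<close>, the only one with negative coefficients.\<close>
  also have "\<dots> = (q - p) * T" by (simp add: T(2) px flip: mult.assoc)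
  finally have "fps_nonneg (1 - fps_Exp f - p)" using q T(1) by (simp add: fps_nonneg_mult)
  moreover have "fps_ln_one_minus (1 - fps_Exp f) = f"
    by (rule fps_ln_one_minus_Exp) (simp add: f)
  ultimately show ?thesis using that[of "1 - fps_Exp f"] by (simp add: f_def)
qed

text \<open>
  The weights are not normalised: \<open>r\<close> is the mean of the points from \<open>m\<close> on with respect to the
  conditional distribution, and stating this after multiplication by the total weight of these
  points avoids conditioning on a null set.
\<close>

lemma chain_mean:
  fixes w :: "nat \<Rightarrow> real" and P :: "nat \<Rightarrow> real fps"
  assumes "m \<le> N" "k \<le> m"
    and w: "\<And>j. j \<in> {k..N} \<Longrightarrow> w j \<ge> 0"
    and P0: "\<And>j. j \<in> {k..N} \<Longrightarrow> P j $ 0 = 0"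
    and P_nonneg: "\<And>j. j \<in> {k..N} \<Longrightarrow> fps_nonneg (P j)"
    and P_mono: "\<And>j. j \<in> {k..<N} \<Longrightarrow> fps_nonneg (P (Suc j) - P j)"
  shows "\<exists>r. r $ 0 = 0 \<and> fps_nonneg (r - P m) \<and>
    (\<Sum>j=m..N. fps_const (w j) * fps_ln_one_minus (P j)) = fps_const (\<Sum>j=m..N. w j) * fps_ln_one_minus r"
  using \<open>m \<le> N\<close> \<open>k \<le> m\<close>
proof (induction m rule: inc_induct)
  case base
  thus ?case using P0[of N] by (intro exI[of _ "P N"]) (simp add: fps_nonneg_def)
next
  case (step m)
  let ?S = "\<lambda>m. \<Sum>j=m..N. fps_const (w j) * fps_ln_one_minus (P j)"
  let ?M = "\<lambda>m. \<Sum>j=m..N. w j"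
  from step obtain r' where r': "r' $ 0 = 0" "fps_nonneg (r' - P (Suc m))"
    "?S (Suc m) = fps_const (?M (Suc m)) * fps_ln_one_minus r'"
    by auto
  have m: "m \<in> {k..N}" "m \<in> {k..<N}" using step by auto
  have S: "?S m = fps_const (w m) * fps_ln_one_minus (P m)
      + fps_const (?M (Suc m)) * fps_ln_one_minus r'"
    using step r'(3) by (simp add: sum.atLeast_Suc_atMost)
  have M: "?M m = w m + ?M (Suc m)" using step by (simp add: sum.atLeast_Suc_atMost)
  have nn: "w m \<ge> 0" "?M (Suc m) \<ge> 0" using w step by (auto intro!: sum_nonneg)
  have dom: "fps_nonneg (r' - P m)"
    using fps_nonneg_add[OF r'(2) P_mono[OF m(2)]] by simp
  show ?case
  proof (cases "?M m = 0")
    case True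
    hence "w m = 0" "?M (Suc m) = 0" using M nn by auto
    thus ?thesis using S True P0[OF m(1)]
      by (intro exI[of _ "P m"]) (simp add: fps_nonneg_def)
  next
    case False
    define b where "b = ?M (Suc m) / ?M m"
    have b: "0 \<le> b" "b \<le> 1" "?M m * (1 - b) = w m" "?M m * b = ?M (Suc m)"
      using False nn M by (auto simp: b_def field_simps)
    obtain r where r: "r $ 0 = 0" "fps_nonneg (r - P m)"
      "fps_ln_one_minus r = fps_const (1 - b) * fps_ln_one_minus (P m) + fps_const b * fps_ln_one_minus r'"
      using two_point_mean[OF P_nonneg[OF m(1)] P0[OF m(1)] dom r'(1) b(1,2)] by blast
    have "fps_const (?M m) * fps_ln_one_minus r = ?S m"
      unfolding r(3) S distrib_left mult.assoc[symmetric] fps_const_mult b(3,4) ..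
    thus ?thesis using r by metis
  qed
qed

theorem mainTheorem2:
  fixes N :: nat
    and \<mu> :: "nat measure"
    and p :: "nat \<Rightarrow> nat \<Rightarrow> real"
  assumes "N \<ge> 1"
    and "prob_space \<mu>"
    and "sets \<mu> = Pow {1..N}"
    and "\<And>i j. i \<ge> 1 \<Longrightarrow> j \<in> {1..N} \<Longrightarrow> p i j \<ge> 0"
    and "\<And>i. i \<ge> 1 \<Longrightarrow> mono_on {1..N} (p i)"
  shows "\<forall>n. fps_nth (1 - (\<Prod>j=1..N. fps_one_minus_powr (fps_at p j) (measure \<mu> {j}))) n \<ge> 0"
proof -
  interpret prob_space \<mu> by fact
  have "space \<mu> = {1..N}"
    using sets_eq_imp_space_eq[of \<mu> "count_space {1..N}"] assms(3) by simp
  hence total: "(\<Sum>j=1..N. measure \<mu> {j}) = 1"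
    using prob_space finite_measure_eq_sum_singleton[of "{1..N}"] assms(3) by simp
  have nonneg: "fps_nonneg (fps_at p j)" if "j \<in> {1..N}" for j
    using assms(4) that by (auto simp: fps_nonneg_def fps_at_def)
  have step: "fps_nonneg (fps_at p (Suc j) - fps_at p j)" if "j \<in> {1..<N}" for j
  proof -
    have "p i j \<le> p i (Suc j)" if "i \<ge> 1" for i
      by (rule mono_onD[OF assms(5)[OF that]]) (use \<open>j \<in> {1..<N}\<close> in auto)
    thus ?thesis by (simp add: fps_nonneg_def fps_at_def)
  qed
  have "\<exists>r. r $ 0 = 0 \<and> fps_nonneg (r - fps_at p 1) \<and>
    (\<Sum>j=1..N. fps_const (measure \<mu> {j}) * fps_ln_one_minus (fps_at p j))
      = fps_const (\<Sum>j=1..N. measure \<mu> {j}) * fps_ln_one_minus r"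
    by (rule chain_mean[where k = 1])
       (use assms(1) in \<open>simp_all add: nonneg step\<close>, simp add: fps_at_def)
  then obtain r where r: "r $ 0 = 0" "fps_nonneg (r - fps_at p 1)"
    "(\<Sum>j=1..N. fps_const (measure \<mu> {j}) * fps_ln_one_minus (fps_at p j)) = fps_ln_one_minus r"
    unfolding total by auto
  have "(\<Prod>j=1..N. fps_one_minus_powr (fps_at p j) (measure \<mu> {j}))
      = fps_Exp (\<Sum>j=1..N. fps_const (measure \<mu> {j}) * fps_ln_one_minus (fps_at p j))"
    by (simp add: fps_one_minus_powr_def fps_Exp_sum)
  also have "\<dots> = 1 - r"
    unfolding r(3) by (rule fps_Exp_ln_one_minus[OF r(1)])
  finally have "1 - (\<Prod>j=1..N. fps_one_minus_powr (fps_at p j) (measure \<mu> {j})) = r"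
    by simp
  moreover have "fps_nonneg r"
    using fps_nonneg_add[OF r(2) nonneg[of 1]] assms(1) by simp
  ultimately show ?thesis by (simp add: fps_nonneg_def)
qed

end
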